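(* Let $G=(V,E)$ be a graph and $k$ an even positive integer such that $|V|\ge k+1$ and $|E|>(k-1)\bigl(|V|-\tfrac{k}{2}\bigr)$. Then $G$ contains a mixed $k$-connected subgraph.
   Context: For a graph $G=(V,E)$, a pair $(S,F)$ with $S\subseteq V$, $F\subseteq E$ is a mixed cut if $G-S-F$ is disconnected. $G$ is mixed $k$-connected if $2|S|+|F|\ge k$ for every mixed cut $(S,F)$ of $G$. *)

theory Defs
  imports Complex_Main
begin

definition simple_graph :: "'a set \<Rightarrow> 'a set set \<Rightarrow> bool" where
  "simple_graph V E \<longleftrightarrow> finite V \<and> (\<forall>e\<in>E. e \<subseteq> V \<and> card e = 2)"

definition subgraph :: "'a set \<Rightarrow> 'a set set \<Rightarrow> 'a set \<Rightarrow> 'a set set \<Rightarrow> bool" where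
  "subgraph W D V E \<longleftrightarrow> simple_graph W D \<and> W \<subseteq> V \<and> D \<subseteq> E"

text \<open>The graph without vertices and the graph with a single vertex count as connected.\<close>

definition connected_graph :: "'a set \<Rightarrow> 'a set set \<Rightarrow> bool" where
  "connected_graph V E \<longleftrightarrow> (\<forall>u\<in>V. \<forall>v\<in>V. (\<lambda>x y. {x, y} \<in> E)\<^sup>*\<^sup>* u v)"

definition mixed_cut :: "'a set \<Rightarrow> 'a set set \<Rightarrow> 'a set \<Rightarrow> 'a set set \<Rightarrow> bool" where
  "mixed_cut V E S F \<longleftrightarrow> S \<subseteq> V \<and> F \<subseteq> E \<and>
     \<not> connected_graph (V - S) ({e \<in> E. e \<inter> S = {}} - F)"

text \<open>A graph with at most one vertex has no mixed cut, so it satisfies this predicate for every k;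
  statements asserting the existence of such a graph must exclude this case.\<close>

definition mixed_connected :: "nat \<Rightarrow> 'a set \<Rightarrow> 'a set set \<Rightarrow> bool" where
  "mixed_connected k V E \<longleftrightarrow> (\<forall>S F. mixed_cut V E S F \<longrightarrow> k \<le> 2 * card S + card F)"

end

theory Submission
  imports Defs
begin

text \<open>
  Write \<open>k = 2m\<close> and \<open>f n = (k - 1)(n - m)\<close>. Take an induced subgraph on \<open>n \<ge> k - 1\<close> vertices with
  more than \<open>f n\<close> edges, with \<open>n\<close> minimal. Since \<open>n choose 2 = f n\<close> for \<open>n = k - 1\<close> and \<open>n = k\<close>, we
  have \<open>n > k\<close>, and deleting a single vertex shows that all degrees are at least \<open>k\<close>. Suppose that
  a mixed cut \<open>(S, F)\<close> with \<open>2|S| + |F| < k\<close> separates \<open>A\<close> from \<open>B\<close>. If, say, \<open>|A \<union> S| \<le> k\<close>, then each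
  of the \<open>a\<close> vertices of \<open>A\<close> meets at least \<open>k + 1 - a - |S|\<close> edges of \<open>F\<close>, so that
  \<open>|F| \<ge> a (k + 1 - a - |S|) \<ge> k - |S|\<close>, a contradiction. Otherwise minimality bounds the numbers of
  edges inside \<open>A \<union> S\<close> and inside \<open>B \<union> S\<close> by \<open>f\<close>, and together with \<open>F\<close> these are at most \<open>f n\<close> edges.
\<close>

lemma simple_graph_finite_edges:
  assumes "simple_graph V E"
  shows "finite E"
proof (rule finite_subset)
  show "E \<subseteq> Pow V" "finite (Pow V)"
    using assms by (auto simp: simple_graph_def)
qed

lemma simple_graph_induced:
  assumes "simple_graph V E" "W \<subseteq> V"
  shows "simple_graph W {e \<in> E. e \<subseteq> W}"
  using assms by (auto simp: simple_graph_def intro: finite_subset)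

lemma simple_graph_card_edges:
  assumes "simple_graph V E"
  shows "2 * card E \<le> card V * (card V - 1)"
proof -
  have "finite V" using assms by (simp add: simple_graph_def)
  have "card E \<le> card {e. e \<subseteq> V \<and> card e = 2}"
    using assms by (intro card_mono) (auto simp: simple_graph_def)
  also have "\<dots> = card V choose 2"
    using n_subsets[OF \<open>finite V\<close>] .
  finally show ?thesis
    by (simp add: choose_two)
qed

lemma simple_graph_degree_le:
  assumes "simple_graph V E" "v \<in> V"
  shows "card {e \<in> E. v \<in> e} \<le> card V - 1"
proof -
  have fin: "finite V" using assms by (simp add: simple_graph_def)
  have "{e \<in> E. v \<in> e} \<subseteq> (\<lambda>w. {v, w}) ` (V - {v})"
  proof
    fix e assume e: "e \<in> {e \<in> E. v \<in> e}"
    then have "e \<subseteq> V" "card e = 2" "v \<in> e"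
      using assms by (auto simp: simple_graph_def)
    then obtain w where "e = {v, w}" "w \<noteq> v"
      by (auto simp: card_2_iff)
    with \<open>e \<subseteq> V\<close> show "e \<in> (\<lambda>w. {v, w}) ` (V - {v})" by auto
  qed
  then have "card {e \<in> E. v \<in> e} \<le> card (V - {v})"
    using fin by (meson card_image_le card_mono finite_Diff finite_imageI le_trans)
  then show ?thesis using assms fin by simp
qed

text \<open>\<open>A\<close> is what a vertex \<open>u\<close> still reaches after the deletion and
  \<open>B\<close> is the rest, so an edge that avoids \<open>S\<close> and \<open>F\<close> cannot
  leave \<open>A\<close>. An edge meeting \<open>S\<close> has at most one end outside
  \<open>S\<close>.\<close>

lemma mixed_cut_separation:
  assumes "simple_graph V E" "mixed_cut V E S F"
  obtains A B where "A \<noteq> {}" "B \<noteq> {}" "V = A \<union> B \<union> S" "A \<inter> B = {}" "A \<inter> S = {}" "B \<inter> S = {}"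
    and "\<And>e. e \<in> E \<Longrightarrow> e \<subseteq> A \<union> S \<or> e \<subseteq> B \<union> S \<or> e \<in> F"
proof -
  define R where "R = (\<lambda>x y. {x, y} \<in> {e \<in> E. e \<inter> S = {}} - F)"
  obtain u v where uv: "u \<in> V - S" "v \<in> V - S" "\<not> R\<^sup>*\<^sup>* u v" and "S \<subseteq> V"
    using assms(2) unfolding mixed_cut_def connected_graph_def R_def by blast
  define A where "A = {x \<in> V - S. R\<^sup>*\<^sup>* u x}"
  define B where "B = V - S - A"
  show thesis
  proof (rule that[of A B])
    show "A \<noteq> {}" using uv by (auto simp: A_def)
    show "B \<noteq> {}" using uv by (auto simp: A_def B_def)
    show "V = A \<union> B \<union> S" using \<open>S \<subseteq> V\<close> by (auto simp: A_def B_def)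
    show "A \<inter> B = {}" "A \<inter> S = {}" "B \<inter> S = {}" by (auto simp: A_def B_def)
    fix e assume "e \<in> E"
    then have "e \<subseteq> V" "card e = 2" using assms(1) by (auto simp: simple_graph_def)
    then obtain x y where e: "e = {x, y}" by (auto simp: card_2_iff)
    show "e \<subseteq> A \<union> S \<or> e \<subseteq> B \<union> S \<or> e \<in> F"
    proof (cases "e \<inter> S = {} \<and> e \<notin> F")
      case True
      then have "R x y" "R y x" using \<open>e \<in> E\<close> by (auto simp: R_def e insert_commute)
      then have "x \<in> A \<longleftrightarrow> y \<in> A"
        using True \<open>e \<subseteq> V\<close> by (auto simp: A_def e intro: rtranclp.rtrancl_into_rtrancl)
      then show ?thesis using True \<open>e \<subseteq> V\<close> by (auto simp: B_def e)
    next
      case False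
      then show ?thesis using \<open>e \<subseteq> V\<close> by (auto simp: B_def e)
    qed
  qed
qed

lemma separation_small_side_cut_ge:
  assumes G: "simple_graph V E"
    and V: "V = A \<union> B \<union> S" "A \<inter> B = {}" "A \<inter> S = {}" "A \<noteq> {}"
    and edges: "\<And>e. e \<in> E \<Longrightarrow> e \<subseteq> A \<union> S \<or> e \<subseteq> B \<union> S \<or> e \<in> F"
    and "F \<subseteq> E"
    and deg: "\<And>v. v \<in> A \<Longrightarrow> k \<le> card {e \<in> E. v \<in> e}"
    and small: "card A + card S \<le> k"
  shows "k \<le> card S + card F"
proof -
  have fin: "finite V" "finite A" "finite S" "finite E" "finite F"
    using G V simple_graph_finite_edges[OF G] \<open>F \<subseteq> E\<close>
    by (auto simp: simple_graph_def intro: finite_subset)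
  \<comment> \<open>\<open>X\<close> consists of the edges running between \<open>A\<close> and
    \<open>B\<close>, which the cut must delete.\<close>
  define X where "X = {e \<in> E. \<not> e \<subseteq> A \<union> S \<and> \<not> e \<subseteq> B \<union> S}"
  have "X \<subseteq> F" using edges by (auto simp: X_def)
  have AS: "card (A \<union> S) = card A + card S"
    using fin V by (simp add: card_Un_disjoint)
  have a: "1 \<le> card A" using V fin by (simp add: Suc_leI card_gt_0_iff)
  have cross: "k + 1 - card A - card S \<le> card {e \<in> X. v \<in> e}" if "v \<in> A" for v
  proof -
    have "simple_graph (A \<union> S) {e \<in> E. e \<subseteq> A \<union> S}"
      using simple_graph_induced[OF G] V by blast
    from simple_graph_degree_le[OF this, of v] that
    have inside: "card {e \<in> {e \<in> E. e \<subseteq> A \<union> S}. v \<in> e} \<le> card A + card S - 1"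
      by (simp add: AS)
    have "{e \<in> E. v \<in> e} \<subseteq> {e \<in> {e \<in> E. e \<subseteq> A \<union> S}. v \<in> e} \<union> {e \<in> X. v \<in> e}"
      using that V by (auto simp: X_def)
    then have "card {e \<in> E. v \<in> e} \<le>
        card ({e \<in> {e \<in> E. e \<subseteq> A \<union> S}. v \<in> e} \<union> {e \<in> X. v \<in> e})"
      using fin by (intro card_mono) (auto simp: X_def)
    also have "\<dots> \<le> card {e \<in> {e \<in> E. e \<subseteq> A \<union> S}. v \<in> e} + card {e \<in> X. v \<in> e}"
      by (rule card_Un_le)
    finally show ?thesis using deg[OF that] inside a by linarith
  qed
  \<comment> \<open>An edge of \<open>X\<close> has only one end in \<open>A\<close>, so summing
    over \<open>A\<close> counts no edge twice.\<close>
  have disj: "{e \<in> X. v \<in> e} \<inter> {e \<in> X. w \<in> e} = {}" if "v \<in> A" "w \<in> A" "v \<noteq> w" for v w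
  proof -
    have "e \<subseteq> A" if "e \<in> X" "v \<in> e" "w \<in> e" for e
    proof -
      have "card e = 2" using G that by (auto simp: X_def simple_graph_def)
      then have "e = {v, w}" using that \<open>v \<noteq> w\<close> by (auto simp: card_2_iff)
      then show ?thesis using \<open>v \<in> A\<close> \<open>w \<in> A\<close> by simp
    qed
    then show ?thesis by (auto simp: X_def)
  qed
  have "card A * (k + 1 - card A - card S) \<le> (\<Sum>v\<in>A. card {e \<in> X. v \<in> e})"
    using sum_bounded_below[of A "k + 1 - card A - card S"] cross by simp
  also have "\<dots> = card (\<Union>v\<in>A. {e \<in> X. v \<in> e})"
    using fin disj by (subst card_UN_disjoint) (auto simp: X_def)
  also have "\<dots> \<le> card F"
    using \<open>X \<subseteq> F\<close> fin by (intro card_mono) auto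
  finally have le: "card A * (k + 1 - card A - card S) \<le> card F" .
  \<comment> \<open>This removes the truncated subtractions: the product bound becomes
    \<open>(p + 1) * (q + 1)\<close>, which is at least \<open>p + q + 1\<close>, that is,
    \<open>k - card S\<close>.\<close>
  obtain p q where p: "card A = p + 1" and q: "k = p + 1 + card S + q"
    using a small by (metis add.commute le_Suc_ex)
  have "k + 1 - card A - card S = q + 1" using p q by simp
  with le have "(p + 1) * (q + 1) \<le> card F" by (simp add: p)
  then show ?thesis using q by (simp add: algebra_simps)
qed

text \<open>At orders \<open>2 * m - 1\<close> and \<open>2 * m\<close> the threshold is exactly the
  number of edges of the complete graph, so it cannot be exceeded there.\<close>

lemma dense_graph_order:
  assumes "simple_graph V E" "2 * m - 1 \<le> card V" "0 < m"
    and "(2 * int m - 1) * (int (card V) - int m) < int (card E)"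
  shows "2 * m < card V"
proof (rule ccontr)
  assume "\<not> 2 * m < card V"
  moreover obtain p where p: "m = Suc p" using \<open>0 < m\<close> by (cases m) auto
  ultimately consider "card V = 2 * p + 1" | "card V = 2 * p + 2" using assms(2) by linarith
  then have "int (card V * (card V - 1)) = 2 * ((2 * int m - 1) * (int (card V) - int m))"
    by cases (simp_all add: p algebra_simps)
  moreover have "int (2 * card E) \<le> int (card V * (card V - 1))"
    using simple_graph_card_edges[OF assms(1)] by linarith
  ultimately show False using assms(4) by linarith
qed

text \<open>The bound \<open>min\<close> is applied to \<open>V - {v}\<close>, which gives the
  minimum degree, and to \<open>A \<union> S\<close> and \<open>B \<union> S\<close> for a cut that
  is too small.\<close>

lemma minimal_dense_graph_mixed_connected:
  assumes G: "simple_graph V E" and m: "0 < m" and V: "2 * m < card V"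
    and dense: "(2 * int m - 1) * (int (card V) - int m) < int (card E)"
    and min: "\<And>W. W \<subset> V \<Longrightarrow> 2 * m - 1 \<le> card W \<Longrightarrow>
      int (card {e \<in> E. e \<subseteq> W}) \<le> (2 * int m - 1) * (int (card W) - int m)"
  shows "mixed_connected (2 * m) V E"
  unfolding mixed_connected_def
proof (intro allI impI, rule ccontr)
  fix S F
  assume cut: "mixed_cut V E S F" and "\<not> 2 * m \<le> 2 * card S + card F"
  then have less: "2 * card S + card F < 2 * m" by simp
  have fin: "finite V" "finite E" using G simple_graph_finite_edges[OF G]
    by (auto simp: simple_graph_def)
  have F: "F \<subseteq> E" using cut by (simp add: mixed_cut_def)
  have finF: "finite F" using finite_subset[OF F fin(2)] .
  \<comment> \<open>Removing \<open>v\<close> lowers the threshold by \<open>2 * m - 1\<close>.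
    Since \<open>V\<close> exceeds its threshold and \<open>V - {v}\<close> does not, more than
    \<open>2 * m - 1\<close> edges contain \<open>v\<close>.\<close>
  have deg: "2 * m \<le> card {e \<in> E. v \<in> e}" if "v \<in> V" for v
  proof -
    have "card (V - {v}) = card V - 1" using that fin by simp
    moreover from this
    have "int (card {e \<in> E. e \<subseteq> V - {v}}) \<le> (2 * int m - 1) * (int (card (V - {v})) - int m)"
      using that V by (intro min) auto
    ultimately have "int (card {e \<in> E. e \<subseteq> V - {v}}) \<le>
        (2 * int m - 1) * (int (card V) - int m) - (2 * int m - 1)"
      using V by (simp add: of_nat_diff algebra_simps)
    moreover have "card E \<le> card {e \<in> E. e \<subseteq> V - {v}} + card {e \<in> E. v \<in> e}"
    proof -
      have "E = {e \<in> E. e \<subseteq> V - {v}} \<union> {e \<in> E. v \<in> e}"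
        using G by (auto simp: simple_graph_def)
      then show ?thesis by (metis card_Un_le)
    qed
    ultimately show ?thesis using dense by linarith
  qed
  obtain A B where AB: "A \<noteq> {}" "B \<noteq> {}" "V = A \<union> B \<union> S" "A \<inter> B = {}" "A \<inter> S = {}" "B \<inter> S = {}"
    and edges: "\<And>e. e \<in> E \<Longrightarrow> e \<subseteq> A \<union> S \<or> e \<subseteq> B \<union> S \<or> e \<in> F"
    using mixed_cut_separation[OF G cut] by metis
  have finAB: "finite A" "finite B" "finite S" using AB fin by auto
  have large_A: "2 * m < card A + card S"
  proof (rule ccontr)
    assume "\<not> ?thesis"
    then have "2 * m \<le> card S + card F"
      using G AB edges F deg
      by (intro separation_small_side_cut_ge[of V E A B S F "2 * m"]) auto
    with less m show False by linarith
  qed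
  have large_B: "2 * m < card B + card S"
  proof (rule ccontr)
    assume "\<not> ?thesis"
    moreover have "V = B \<union> A \<union> S" "B \<inter> A = {}" using AB by auto
    moreover have "e \<subseteq> B \<union> S \<or> e \<subseteq> A \<union> S \<or> e \<in> F" if "e \<in> E" for e
      using edges[OF that] by blast
    ultimately have "2 * m \<le> card S + card F"
      using G AB F deg
      by (intro separation_small_side_cut_ge[of V E B A S F "2 * m"]) auto
    with less m show False by linarith
  qed
  have cards: "card (A \<union> S) = card A + card S" "card (B \<union> S) = card B + card S"
    using finAB AB by (auto simp: card_Un_disjoint)
  have "card V = card A + card B + card S"
    using finAB AB by (simp add: card_Un_disjoint Int_Un_distrib2)
  define c s where "c = 2 * int m - 1" and "s = int (card S)"
  \<comment> \<open>As the other side is nonempty, \<open>A \<union> S\<close> and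
    \<open>B \<union> S\<close> are proper subsets of \<open>V\<close>.\<close>
  have "int (card {e \<in> E. e \<subseteq> A \<union> S}) \<le> c * (int (card (A \<union> S)) - int m)"
    unfolding c_def using AB large_A cards by (intro min) auto
  moreover have "int (card {e \<in> E. e \<subseteq> B \<union> S}) \<le> c * (int (card (B \<union> S)) - int m)"
    unfolding c_def using AB large_B cards by (intro min) auto
  moreover have "card E \<le> card {e \<in> E. e \<subseteq> A \<union> S} + card {e \<in> E. e \<subseteq> B \<union> S} + card F"
  proof -
    have "card E \<le> card ({e \<in> E. e \<subseteq> A \<union> S} \<union> {e \<in> E. e \<subseteq> B \<union> S} \<union> F)"
      using edges fin finF by (intro card_mono) auto
    also have "\<dots> \<le> card ({e \<in> E. e \<subseteq> A \<union> S} \<union> {e \<in> E. e \<subseteq> B \<union> S}) + card F"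
      by (rule card_Un_le)
    also have "\<dots> \<le> card {e \<in> E. e \<subseteq> A \<union> S} + card {e \<in> E. e \<subseteq> B \<union> S} + card F"
      using card_Un_le by simp
    finally show ?thesis .
  qed
  ultimately have "int (card E) \<le> c * (int (card (A \<union> S)) - int m)
      + c * (int (card (B \<union> S)) - int m) + int (card F)"
    by linarith
  \<comment> \<open>The two sides overlap in \<open>S\<close>, so their orders add up to
    \<open>card V + card S\<close>.\<close>
  also have "\<dots> = c * (int (card V) - int m) - c * (int m - s) + int (card F)"
    using cards \<open>card V = _\<close> by (simp add: s_def algebra_simps)
  \<comment> \<open>From \<open>2 * card S + card F < 2 * m\<close> follow both
    \<open>card F \<le> c\<close> and \<open>s \<le> m - 1\<close>.\<close>
  also have "\<dots> \<le> c * (int (card V) - int m)"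
  proof -
    have "int (card F) \<le> c * 1" using less by (simp add: c_def)
    also have "\<dots> \<le> c * (int m - s)"
      using less m by (intro mult_left_mono) (auto simp: c_def s_def)
    finally show ?thesis by simp
  qed
  finally show False using dense by (simp add: c_def)
qed

theorem theorem5p5:
  fixes V :: "'a set" and E :: "'a set set" and k :: nat
  assumes "simple_graph V E"
    and "even k" and "k > 0"
    and "card V \<ge> k + 1"
    and "real (card E) > (real k - 1) * (real (card V) - real k / 2)"
  shows "\<exists>W D. subgraph W D V E \<and> card W \<ge> 2 \<and> mixed_connected k W D"
proof -
  obtain m where k: "k = 2 * m" using \<open>even k\<close> by blast
  have m: "0 < m" using \<open>k > 0\<close> k by simp
  \<comment> \<open>The lower bound on \<open>card W\<close> matters: below order
    \<open>2 * m - 1\<close> the threshold is less than the number of edges of a complete graph, so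
    a smallest dense set could be tiny.\<close>
  define P where "P W \<longleftrightarrow> W \<subseteq> V \<and> 2 * m - 1 \<le> card W \<and>
    (2 * int m - 1) * (int (card W) - int m) < int (card {e \<in> E. e \<subseteq> W})" for W
  \<comment> \<open>With \<open>k = 2 * m\<close> the real threshold is an integer, so the
    hypothesis transfers to \<open>int\<close>.\<close>
  have "real_of_int ((2 * int m - 1) * (int (card V) - int m)) < real_of_int (int (card E))"
    using assms(5) by (simp add: k)
  then have "(2 * int m - 1) * (int (card V) - int m) < int (card E)"
    by (simp only: of_int_less_iff)
  moreover have "{e \<in> E. e \<subseteq> V} = E" using assms(1) by (auto simp: simple_graph_def)
  ultimately have "P V" using assms(4) by (simp add: P_def k)
  then obtain W where W: "P W" and least: "\<And>U. P U \<Longrightarrow> card W \<le> card U"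
    using exists_least_iff[of "\<lambda>n. \<exists>W. P W \<and> card W = n"] by (metis not_less)
  let ?D = "{e \<in> E. e \<subseteq> W}"
  have sub: "W \<subseteq> V" using W by (simp add: P_def)
  have G: "simple_graph W ?D" using simple_graph_induced[OF assms(1) sub] .
  have order: "2 * m < card W"
    using dense_graph_order[OF G _ m] W by (simp add: P_def)
  have "mixed_connected (2 * m) W ?D"
  proof (rule minimal_dense_graph_mixed_connected[OF G m order])
    show "(2 * int m - 1) * (int (card W) - int m) < int (card ?D)"
      using W by (simp add: P_def)
    fix U assume U: "U \<subset> W" "2 * m - 1 \<le> card U"
    have "finite W" using G by (simp add: simple_graph_def)
    then have "\<not> P U" using least[of U] psubset_card_mono[OF _ U(1)] by auto
    \<comment> \<open>Inducing on \<open>W\<close> and then on \<open>U\<close> is the same as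
      inducing on \<open>U\<close>, so minimality of \<open>W\<close> speaks about
      \<open>?D\<close>.\<close>
    moreover have "{e \<in> ?D. e \<subseteq> U} = {e \<in> E. e \<subseteq> U}" using U by auto
    ultimately show "int (card {e \<in> ?D. e \<subseteq> U}) \<le> (2 * int m - 1) * (int (card U) - int m)"
      using U sub by (auto simp: P_def)
  qed
  moreover have "subgraph W ?D V E" using G sub by (auto simp: subgraph_def)
  moreover have "2 \<le> card W" using order m by linarith
  ultimately show ?thesis using k by blast
qed

end
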